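(* Let $c>0$ and $v_1^+,v_1^-\in\mathbb{R}$ be constants, put $w_1=(v_1^++v_1^-)/2$ and $V_1=(v_1^+-v_1^-)/2$, and let $\gamma\ge 1$. Let $\widetilde{\mathcal F}^\pm$ (defined for $x_2\gtrless 0$) be such that $$\lim_{x_2\to+\infty}\widehat{\mathcal F}^\pm(\cdot,\pm x_2)=0 .$$ Assume that $\widetilde f=\widetilde f(t,x_1)$, $\widetilde P^\pm=\widetilde P^\pm(t,x_1,x_2)$ (defined for $x_2\gtrless0$) is a solution of $$(\gamma+\partial_t+w_1\partial_1)^2\widetilde f+V_1^2\,\partial_{11}^2\widetilde f+\frac{c^2}{2}\,\partial_2(\widetilde P^++\widetilde P^-)=0\qquad\text{at }x_2=0,$$ $$\begin{cases}(\gamma+\partial_t+v_1^\pm\partial_1)^2\widetilde P^\pm-c^2\Delta\widetilde P^\pm=\widetilde{\mathcal F}^\pm & \text{for }x_2\gtrless 0,\\ [\widetilde P]=0 & \text{at }x_2=0,\\ [c^2\partial_2\widetilde P]=-4V_1(\gamma+\partial_t+w_1\partial_1)\partial_1\widetilde f & \text{at }x_2=0,\end{cases}$$ with $$\lim_{x_2\to+\infty}\widehat P^\pm(\cdot,\pm x_2)=0 .$$ Then $\widehat f$ satisfies, with $\tau=\gamma+i\delta$, the second order pseudo-differential equation $$\left((\tau+iw_1\eta)^2+V_1^2\eta^2\left(\frac{8(\tau+iw_1\eta)^2}{c^2(\mu^++\mu^-)^2}-1\right)\right)\widehat f+\frac{\mu^+\mu^-}{\mu^++\mu^-}\,M=0,$$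 where $\mu^\pm=\sqrt{\left(\frac{\tau+iv_1^\pm\eta}{c}\right)^2+\eta^2}$ is the square root such that $\Re\mu^\pm>0$ if $\Re\tau>0$, and $$M=M(\tau,\eta):=\frac1{\mu^+}\int_0^{+\infty}e^{-\mu^+y}\,\widehat{\mathcal F}^+(\cdot,y)\,dy-\frac1{\mu^-}\int_0^{+\infty}e^{-\mu^-y}\,\widehat{\mathcal F}^-(\cdot,-y)\,dy .$$
   Context: Variables: $t\in\mathbb{R}$, $x=(x_1,x_2)\in\mathbb{R}^2$; $\partial_1,\partial_2$ are the derivatives in $x_1,x_2$ and $\Delta=\partial_{11}^2+\partial_{22}^2$. Functions with superscript $+$ (resp. $-$) live on $\{x_2>0\}$ (resp. $\{x_2<0\}$), and $[g]=g^+|_{x_2=0}-g^-|_{x_2=0}$ denotes the jump across $x_2=0$. The functions $\widetilde f=e^{-\gamma t}f$, $\widetilde P^\pm=e^{-\gamma t}P^\pm$, $\widetilde{\mathcal F}^\pm=e^{-\gamma t}\mathcal F^\pm$ are weighted versions of $f,P^\pm,\mathcal F^\pm$. Hats $\widehat f,\widehat P^\pm,\widehat{\mathcal F}^\pm$ denote the Fourier transforms of $\widetilde f,\widetilde P^\pm,\widetilde{\mathcal F}^\pm$ in $(t,x_1)$, with dual variables $(\delta,\eta)\in\mathbb{R}^2$ (so $\partial_t\mapsto i\delta$, $\partial_1\mapsto i\eta$), the variable $x_2$ being kept; the dot in $\widehat{\mathcal F}^\pm(\cdot,y)$ stands for $(\delta,\eta)$, and the limits as $x_2\to+\infty$ are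 taken for fixed $(\delta,\eta)$. As is implicit, all functions are regular enough that the partial Fourier transforms are well-defined functions, that the Fourier-transformed equations hold, for each $(\delta,\eta)$, as an ordinary differential problem in $x_2$ with boundary values at $x_2=0$, and that the integrals make sense. *)

theory Defs
  imports "HOL-Analysis.Analysis"
begin

text \<open>
  All functions are weighted ones (the tilde functions). A function of \<open>(t, x\<^sub>1)\<close> has type
  \<open>real \<Rightarrow> real \<Rightarrow> complex\<close>, one of \<open>(t, x\<^sub>1, x\<^sub>2)\<close> type \<open>real \<Rightarrow> real \<Rightarrow> real \<Rightarrow> complex\<close>; complex
  values include the real-valued case. A function on the half-space \<open>x\<^sub>2 \<in> S\<close>, where \<open>S\<close> is
  \<open>{0<..}\<close> or \<open>{..<0}\<close>, is a total function whose values for \<open>x\<^sub>2 \<notin> S\<close> are never used; its value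
  at \<open>x\<^sub>2 = 0\<close> is the one-sided limit \<open>bdry_trace\<close>.
\<close>

definition slice :: "(real \<Rightarrow> real \<Rightarrow> real \<Rightarrow> complex) \<Rightarrow> real \<Rightarrow> real \<Rightarrow> real \<Rightarrow> complex" where
  "slice g x2 = (\<lambda>t x1. g t x1 x2)"

definition Dt :: "(real \<Rightarrow> real \<Rightarrow> complex) \<Rightarrow> real \<Rightarrow> real \<Rightarrow> complex" where
  "Dt g t x1 = vector_derivative (\<lambda>s. g s x1) (at t)"

definition D1 :: "(real \<Rightarrow> real \<Rightarrow> complex) \<Rightarrow> real \<Rightarrow> real \<Rightarrow> complex" where
  "D1 g t x1 = vector_derivative (\<lambda>y. g t y) (at x1)"

definition D2 :: "(real \<Rightarrow> real \<Rightarrow> real \<Rightarrow> complex) \<Rightarrow> real \<Rightarrow> real \<Rightarrow> real \<Rightarrow> complex" where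
  "D2 g t x1 x2 = vector_derivative (\<lambda>y. g t x1 y) (at x2)"

text \<open>The operator \<open>\<gamma> + \<partial>\<^sub>t + v \<partial>\<^sub>1\<close>; its square is its composition with itself.\<close>

definition transport :: "real \<Rightarrow> real \<Rightarrow> (real \<Rightarrow> real \<Rightarrow> complex) \<Rightarrow> real \<Rightarrow> real \<Rightarrow> complex" where
  "transport \<gamma> v g t x1 = of_real \<gamma> * g t x1 + Dt g t x1 + of_real v * D1 g t x1"

definition laplacian :: "(real \<Rightarrow> real \<Rightarrow> real \<Rightarrow> complex) \<Rightarrow> real \<Rightarrow> real \<Rightarrow> real \<Rightarrow> complex" where
  "laplacian g t x1 x2 = D1 (D1 (slice g x2)) t x1 + D2 (D2 g) t x1 x2"

definition bdry_trace :: "real set \<Rightarrow> (real \<Rightarrow> real \<Rightarrow> real \<Rightarrow> complex) \<Rightarrow> real \<Rightarrow> real \<Rightarrow> complex" where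
  "bdry_trace S g t x1 = Lim (at 0 within S) (\<lambda>x2. g t x1 x2)"

definition jump ::
  "(real \<Rightarrow> real \<Rightarrow> real \<Rightarrow> complex) \<Rightarrow> (real \<Rightarrow> real \<Rightarrow> real \<Rightarrow> complex) \<Rightarrow> real \<Rightarrow> real \<Rightarrow> complex" where
  "jump gp gm t x1 = bdry_trace {0<..} gp t x1 - bdry_trace {..<0} gm t x1"

text \<open>
  Fourier transform in \<open>(t, x\<^sub>1)\<close>, with the sign for which \<open>\<partial>\<^sub>t\<close> becomes \<open>\<i> \<delta>\<close> and \<open>\<partial>\<^sub>1\<close> becomes
  \<open>\<i> \<eta>\<close>; the normalisation is immaterial, since everything below is linear.
\<close>

definition fourier :: "(real \<Rightarrow> real \<Rightarrow> complex) \<Rightarrow> real \<Rightarrow> real \<Rightarrow> complex" where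
  "fourier g \<delta> \<eta> =
     (LINT z|(lborel :: (real \<times> real) measure).
        exp (- (\<i> * of_real (\<delta> * fst z + \<eta> * snd z))) * g (fst z) (snd z))"

definition pfourier :: "(real \<Rightarrow> real \<Rightarrow> real \<Rightarrow> complex) \<Rightarrow> real \<Rightarrow> real \<Rightarrow> real \<Rightarrow> complex" where
  "pfourier g \<delta> \<eta> x2 = fourier (slice g x2) \<delta> \<eta>"

definition integrable2 :: "(real \<Rightarrow> real \<Rightarrow> complex) \<Rightarrow> bool" where
  "integrable2 g \<longleftrightarrow> integrable (lborel :: (real \<times> real) measure) (\<lambda>z. g (fst z) (snd z))"

text \<open>
  Regularity in \<open>(t, x\<^sub>1)\<close>: the partial derivatives of order at most two exist everywhere and have
  Fourier transforms given by convergent integrals.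
\<close>

definition tangentially_regular :: "(real \<Rightarrow> real \<Rightarrow> complex) \<Rightarrow> bool" where
  "tangentially_regular g \<longleftrightarrow>
     (\<forall>h \<in> {g, Dt g, D1 g}.
        (\<forall>t x1. (\<lambda>s. h s x1) differentiable (at t) \<and> (\<lambda>y. h t y) differentiable (at x1)) \<and>
        integrable2 h \<and> integrable2 (Dt h) \<and> integrable2 (D1 h))"

text \<open>
  Regularity in \<open>x\<^sub>2\<close>: \<open>g\<close> and \<open>\<partial>\<^sub>2 g\<close> are differentiable in \<open>x\<^sub>2 \<in> S\<close> and have one-sided limits
  at \<open>x\<^sub>2 = 0\<close>, and both operations commute with the Fourier transform in \<open>(t, x\<^sub>1)\<close>. The last part is
  what turns the equations into, for each \<open>(\<delta>, \<eta>)\<close>, an ordinary differential problem in \<open>x\<^sub>2\<close> with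
  boundary values at \<open>x\<^sub>2 = 0\<close>; dominated convergence gives it when \<open>g\<close> and its \<open>x\<^sub>2\<close>-derivatives
  are locally dominated in \<open>x\<^sub>2\<close> by integrable functions of \<open>(t, x\<^sub>1)\<close>.
\<close>

definition normally_regular :: "real set \<Rightarrow> (real \<Rightarrow> real \<Rightarrow> real \<Rightarrow> complex) \<Rightarrow> bool" where
  "normally_regular S g \<longleftrightarrow>
     (\<forall>h \<in> {g, D2 g}.
        (\<forall>x2 \<in> S.
           (\<forall>t x1. (\<lambda>y. h t x1 y) differentiable (at x2)) \<and>
           integrable2 (slice h x2) \<and> integrable2 (slice (D2 h) x2) \<and>
           (\<forall>\<delta> \<eta>. ((\<lambda>y. pfourier h \<delta> \<eta> y) has_vector_derivative pfourier (D2 h) \<delta> \<eta> x2) (at x2))) \<and>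
        (\<forall>t x1. \<exists>l. ((\<lambda>x2. h t x1 x2) \<longlongrightarrow> l) (at 0 within S)) \<and>
        integrable2 (bdry_trace S h) \<and>
        (\<forall>\<delta> \<eta>. ((\<lambda>x2. pfourier h \<delta> \<eta> x2) \<longlongrightarrow> fourier (bdry_trace S h) \<delta> \<eta>) (at 0 within S)))"

definition regular_on :: "real set \<Rightarrow> (real \<Rightarrow> real \<Rightarrow> real \<Rightarrow> complex) \<Rightarrow> bool" where
  "regular_on S g \<longleftrightarrow> (\<forall>x2 \<in> S. tangentially_regular (slice g x2)) \<and> normally_regular S g"

definition mu :: "real \<Rightarrow> real \<Rightarrow> complex \<Rightarrow> real \<Rightarrow> complex" where
  "mu c v \<tau> \<eta> =
     (THE m. m\<^sup>2 = ((\<tau> + \<i> * of_real v * of_real \<eta>) / of_real c)\<^sup>2 + (of_real \<eta>)\<^sup>2 \<and> Re m > 0)"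

lemma mu_ex1:
  fixes c v \<eta> :: real and \<tau> :: complex
  assumes c: "c > 0" and \<tau>: "Re \<tau> > 0"
  shows "\<exists>!m. m\<^sup>2 = ((\<tau> + \<i> * of_real v * of_real \<eta>) / of_real c)\<^sup>2 + (of_real \<eta>)\<^sup>2 \<and> Re m > 0"
proof -
  define z where "z = ((\<tau> + \<i> * of_real v * of_real \<eta>) / of_real c)\<^sup>2 + (of_real \<eta>)\<^sup>2"
  have q: "(\<tau> + \<i> * of_real v * of_real \<eta>) / of_real c
             = Complex (Re \<tau> / c) ((Im \<tau> + v * \<eta>) / c)"
    by (rule complex_eqI) (simp_all only: Re_divide_of_real Im_divide_of_real, simp_all)
  have Rz: "Re z = (Re \<tau> / c)\<^sup>2 - ((Im \<tau> + v * \<eta>) / c)\<^sup>2 + \<eta>\<^sup>2"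
    unfolding z_def q by (simp only: power2_eq_square plus_complex.sel times_complex.sel
        complex.sel Re_complex_of_real Im_complex_of_real, simp?)
  have Iz: "Im z = 2 * (Re \<tau> / c) * ((Im \<tau> + v * \<eta>) / c)"
    unfolding z_def q by (simp only: power2_eq_square plus_complex.sel times_complex.sel
        complex.sel Re_complex_of_real Im_complex_of_real, simp?)
  have "Re (csqrt z) \<noteq> 0"
  proof
    assume R: "Re (csqrt z) = 0"
    have I0: "Im ((csqrt z)\<^sup>2) = 0" and R0: "Re ((csqrt z)\<^sup>2) \<le> 0"
      unfolding power2_eq_square times_complex.sel R by simp_all
    have "Im z = 0" and Rz0: "Re z \<le> 0"
      using I0 R0 unfolding power2_csqrt by simp_all
    with Iz have "2 * (Re \<tau> / c) * ((Im \<tau> + v * \<eta>) / c) = 0" by metis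
    with c \<tau> have "Im \<tau> + v * \<eta> = 0" by auto
    then have "Re z = (Re \<tau> / c)\<^sup>2 + \<eta>\<^sup>2" using Rz by simp
    moreover have "(Re \<tau> / c)\<^sup>2 > 0" using c \<tau> by simp
    ultimately show False using Rz0 zero_le_power2[of \<eta>] by linarith
  qed
  then have pos: "Re (csqrt z) > 0" using Re_csqrt[of z] by linarith
  show ?thesis
    unfolding z_def[symmetric]
  proof (rule ex1I[of _ "csqrt z"])
    fix m assume m: "m\<^sup>2 = z \<and> Re m > 0"
    then have "m\<^sup>2 = (csqrt z)\<^sup>2" unfolding power2_csqrt by blast
    then have "m = csqrt z \<or> m = - csqrt z" by (simp only: power2_eq_iff)
    moreover have "Re m \<noteq> Re (- csqrt z)" using m pos unfolding uminus_complex.sel by linarith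
    ultimately show "m = csqrt z" by metis
  next
    show "(csqrt z)\<^sup>2 = z \<and> Re (csqrt z) > 0" using pos unfolding power2_csqrt by blast
  qed
qed

text \<open>\<open>mp\<close> and \<open>mm\<close> stand for \<open>\<mu>\<^sup>\<plusminus>(\<tau>, \<eta>)\<close>; \<open>Fp\<close> and \<open>Fm\<close> are the untransformed sources.\<close>

definition source_term ::
  "complex \<Rightarrow> complex \<Rightarrow> (real \<Rightarrow> real \<Rightarrow> real \<Rightarrow> complex) \<Rightarrow> (real \<Rightarrow> real \<Rightarrow> real \<Rightarrow> complex) \<Rightarrow>
   real \<Rightarrow> real \<Rightarrow> complex" where
  "source_term mp mm Fp Fm \<delta> \<eta> =
     1 / mp * (LINT y:{0<..}|lborel. exp (- (mp * of_real y)) * pfourier Fp \<delta> \<eta> y)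
   - 1 / mm * (LINT y:{0<..}|lborel. exp (- (mm * of_real y)) * pfourier Fm \<delta> \<eta> (- y))"

end

theory Submission
  imports Defs
begin

text \<open>The Fourier transform in \<open>(t, x\<^sub>1)\<close> turns the interior equations into
  \<open>P'' = \<mu>\<^sup>2 P - F / c\<^sup>2\<close> on each half-line. A decaying solution of such an equation has only one
  free constant, which gives one linear relation between the boundary values of \<open>P\<close> and \<open>\<partial>\<^sub>2 P\<close>
  on each side. Together with the two jump conditions, these relations determine the boundary values
  in terms of \<open>f\<close> and of the sources; inserting them into the front equation gives the claim.\<close>

section \<open>Limits at infinity and integrals of derivatives on the real line\<close>

text \<open>The increments \<open>G (y + 1) - G y\<close> tend to 0 because \<open>G\<close>
  converges, and to \<open>L\<close> because \<open>g\<close> is almost constant on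
  \<open>{y..y + 1}\<close> for large \<open>y\<close>.\<close>

lemma tendsto_derivative_at_top_zero:
  fixes G g :: "real \<Rightarrow> 'a :: real_normed_vector"
  assumes deriv: "\<And>y. y \<ge> a \<Longrightarrow> (G has_vector_derivative g y) (at y)"
    and G: "(G \<longlongrightarrow> l) at_top"
    and g: "(g \<longlongrightarrow> L) at_top"
  shows "L = 0"
proof -
  have shift: "filterlim (\<lambda>y::real. y + 1) at_top at_top"
    by (rule filterlim_tendsto_add_at_top[OF tendsto_const filterlim_ident, of 1, simplified add.commute])
  have "((\<lambda>y. G (y + 1) - G y) \<longlongrightarrow> l - l) at_top"
    by (intro tendsto_diff G filterlim_compose[OF G shift])
  then have inc: "((\<lambda>y. G (y + 1) - G y) \<longlongrightarrow> 0) at_top" by simp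
  have "((\<lambda>y. G (y + 1) - G y) \<longlongrightarrow> L) at_top"
  proof (rule tendstoI)
    \<comment> \<open>With \<open>g\<close> within \<open>e / 4\<close> of \<open>L\<close>, its
      oscillation on a unit interval is at most \<open>e / 2\<close>. The increment is then within
      \<open>e / 2 + e / 4 < e\<close> of \<open>L\<close>.\<close>
    fix e :: real assume "e > 0"
    then have "eventually (\<lambda>y. dist (g y) L < e / 4) at_top"
      using tendstoD[OF g, of "e / 4"] by simp
    then obtain b where b: "\<And>y. y \<ge> b \<Longrightarrow> dist (g y) L < e / 4"
      unfolding eventually_at_top_linorder by blast
    show "eventually (\<lambda>y. dist (G (y + 1) - G y) L < e) at_top"
      unfolding eventually_at_top_linorder
    proof (intro exI allI impI)
      fix y assume y: "y \<ge> max a b"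
      have "norm (G (y + 1) - G y - ((y + 1) - y) *\<^sub>R g y) \<le> norm ((y + 1) - y) * (e / 2)"
      proof (rule vector_differentiable_bound_linearization)
        show "(G has_vector_derivative g x) (at x within {y..y + 1})" if "x \<in> {y..y + 1}" for x
          using that y by (auto intro: has_vector_derivative_at_within[OF deriv])
        show "closed_segment y (y + 1) \<subseteq> {y..y + 1}"
          by (simp add: closed_segment_eq_real_ivl)
        show "norm (g x - g y) \<le> e / 2" if "x \<in> {y..y + 1}" for x
          using b[of x] b[of y] dist_triangle2[of "g x" "g y" L] that y
          by (simp add: dist_norm)
      qed auto
      then have "dist (G (y + 1) - G y) (g y) \<le> e / 2" by (simp add: dist_norm)
      then show "dist (G (y + 1) - G y) L < e"
        using b[of y] y dist_triangle[of "G (y + 1) - G y" L "g y"] \<open>e > 0\<close> by simp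
    qed
  qed
  with inc show ?thesis by (rule tendsto_unique[OF trivial_limit_at_top_linorder, THEN sym])
qed

text \<open>The fundamental theorem of calculus evaluates the integral over \<open>{a..b}\<close>.
  Integrability identifies the gauge and Lebesgue integrals and lets \<open>b\<close> tend to
  infinity.\<close>

lemma tendsto_at_top_of_integrable_derivative:
  fixes G g :: "real \<Rightarrow> 'a :: euclidean_space"
  assumes deriv: "\<And>y. y \<ge> a \<Longrightarrow> (G has_vector_derivative g y) (at y)"
    and int: "set_integrable lborel {a..} g"
  shows "(G \<longlongrightarrow> G a + (LINT y:{a..}|lborel. g y)) at_top"
proof -
  have "(LINT y:{a..b}|lborel. g y) = G b - G a" if "b \<ge> a" for b
  proof -
    have "set_integrable lborel {a..b} g"
      by (rule set_integrable_subset[OF int]) auto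
    moreover have "(g has_integral (G b - G a)) {a..b}"
      using that by (intro fundamental_theorem_of_calculus has_vector_derivative_at_within[OF deriv]) auto
    ultimately show ?thesis
      by (metis set_borel_integral_eq_integral(2) integral_unique)
  qed
  then have "eventually (\<lambda>b. G a + (LINT y:{a..b}|lborel. g y) = G b) at_top"
    unfolding eventually_at_top_linorder by (intro exI[of _ a]) auto
  moreover have "((\<lambda>b. G a + (LINT y:{a..b}|lborel. g y)) \<longlongrightarrow> G a + (LINT y:{a..}|lborel. g y)) at_top"
    by (intro tendsto_add tendsto_const tendsto_set_lebesgue_integral_at_top int) auto
  ultimately show ?thesis by (rule Lim_transform_eventually[rotated])
qed

text \<open>Integrability of \<open>g\<close> gives \<open>G\<close> a limit \<open>L\<close>.
  Integrability of \<open>G\<close> makes its antiderivative converge as well, and a convergent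
  function whose derivative converges has derivative tending to 0, so \<open>L = 0\<close>.\<close>

lemma tendsto_at_top_zero_of_integrable:
  fixes G g :: "real \<Rightarrow> 'a :: euclidean_space"
  assumes deriv: "\<And>y. (G has_vector_derivative g y) (at y)"
    and G: "integrable lborel G" and g: "integrable lborel g"
  shows "(G \<longlongrightarrow> 0) at_top"
proof -
  have int: "set_integrable lborel {0..} h" if "integrable lborel h" for h :: "real \<Rightarrow> 'a"
    unfolding set_integrable_def using that by (intro integrable_mult_indicator) auto
  define L where "L = G 0 + (LINT y:{0..}|lborel. g y)"
  have L: "(G \<longlongrightarrow> L) at_top"
    unfolding L_def by (rule tendsto_at_top_of_integrable_derivative[OF deriv int[OF g]])
  have cont: "continuous_on S G" for S
    using deriv by (meson continuous_at_imp_continuous_on has_vector_derivative_continuous)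
  \<comment> \<open>For \<open>y \<ge> 1\<close> the point \<open>y\<close> is interior to
    \<open>{0..y + 1}\<close>, so the derivative within the interval is a full derivative.\<close>
  have "((\<lambda>b. integral {0..b} G) has_vector_derivative G y) (at y)" if "y \<ge> 1" for y
  proof -
    have "((\<lambda>b. integral {0..b} G) has_vector_derivative G y) (at y within {0..y + 1})"
      using that by (intro integral_has_vector_derivative cont) auto
    then show ?thesis
      using that by (subst (asm) at_within_interior) auto
  qed
  moreover have "((\<lambda>b. integral {0..b} G) \<longlongrightarrow> (LINT y:{0..}|lborel. G y)) at_top"
  proof -
    have "(LINT y:{0..b}|lborel. G y) = integral {0..b} G" for b
      by (intro set_borel_integral_eq_integral set_integrable_subset[OF int[OF G]]) auto
    then show ?thesis
      using tendsto_set_lebesgue_integral_at_top[OF _ int[OF G]] by simp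
  qed
  ultimately have "L = 0" using L by (rule tendsto_derivative_at_top_zero)
  with L show ?thesis by simp
qed

lemma has_vector_derivative_reflect:
  fixes h :: "real \<Rightarrow> 'a :: real_normed_vector"
  assumes "(h has_vector_derivative h') (at (- y))"
  shows "((\<lambda>y. h (- y)) has_vector_derivative - h') (at y)"
proof -
  have "(uminus has_vector_derivative (-1 :: real)) (at y)"
    using has_vector_derivative_minus[OF has_vector_derivative_id] by simp
  from vector_diff_chain_at[OF this assms] show ?thesis by (simp add: o_def)
qed

text \<open>The boundary terms at both infinities vanish. This is the integration by parts behind
  the rule for Fourier transforms of derivatives.\<close>

lemma integral_derivative_zero:
  fixes G g :: "real \<Rightarrow> 'a :: euclidean_space"
  assumes deriv: "\<And>y. (G has_vector_derivative g y) (at y)"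
    and G: "integrable lborel G" and g: "integrable lborel g"
  shows "(LINT y|lborel. g y) = 0"
proof -
  have int: "set_integrable lborel S g" if "S \<in> sets borel" for S
    unfolding set_integrable_def using that g by (intro integrable_mult_indicator) auto
  have top: "(G \<longlongrightarrow> 0) at_top"
    by (rule tendsto_at_top_zero_of_integrable[OF deriv G g])
  have tail: "(LINT y:{a..}|lborel. g y) = - G a" for a
    using tendsto_unique[OF trivial_limit_at_top_linorder top
        tendsto_at_top_of_integrable_derivative[OF deriv int, of a]]
    by (simp add: eq_neg_iff_add_eq_0 add.commute)
  \<comment> \<open>The limit at minus infinity is the limit at plus infinity of the reflected
    function.\<close>
  have "((\<lambda>y. G (- y)) \<longlongrightarrow> 0) at_top"
  proof (rule tendsto_at_top_zero_of_integrable)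
    show "((\<lambda>y. G (- y)) has_vector_derivative - g (- y)) (at y)" for y
      by (rule has_vector_derivative_reflect[OF deriv])
    show "integrable lborel (\<lambda>y. G (- y))" "integrable lborel (\<lambda>y. - g (- y))"
      using lborel_integrable_real_affine[OF G, of "-1" 0] lborel_integrable_real_affine[OF g, of "-1" 0]
      by simp_all
  qed
  \<comment> \<open>The line is exhausted by the half-lines \<open>{- real n..}\<close>, on which
    the integral is \<open>- G (- real n)\<close>.\<close>
  then have "(\<lambda>n. - G (- real n)) \<longlonglongrightarrow> - 0"
    by (intro tendsto_minus) (rule filterlim_compose[OF _ filterlim_real_sequentially])
  then have "(\<lambda>n. LINT y:{- real n..}|lborel. g y) \<longlonglongrightarrow> 0"
    by (simp add: tail)
  moreover have "(\<lambda>n. LINT y:{- real n..}|lborel. g y) \<longlonglongrightarrow> (LINT y:(\<Union>n. {- real n..})|lborel. g y)"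
    by (intro set_integral_cont_up int) (auto simp: incseq_def)
  ultimately have "(LINT y:(\<Union>n. {- real n..})|lborel. g y) = 0"
    by (rule LIMSEQ_unique[THEN sym])
  moreover have "(\<Union>n. {- real n..}) = UNIV"
    by (auto simp: minus_le_iff intro: real_arch_simple)
  ultimately show ?thesis by (simp add: set_lebesgue_integral_def)
qed

section \<open>Boundary relation for decaying solutions on a half-line\<close>

text \<open>The weight \<open>exp (- m y)\<close> turns the equation into two first-order ones: \<open>exp (- m y) (u' + m u)\<close>
  has derivative \<open>- exp (- m y) \<phi>\<close>, and its limit at infinity is that of the derivative of the
  decaying function \<open>exp (- m y) u\<close>, hence zero.\<close>

lemma decaying_solution_boundary_relation:
  fixes u u' \<phi> :: "real \<Rightarrow> complex"
  assumes m: "Re m > 0"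
    and u: "\<And>y. y > 0 \<Longrightarrow> (u has_vector_derivative u' y) (at y)"
    and u': "\<And>y. y > 0 \<Longrightarrow> (u' has_vector_derivative m\<^sup>2 * u y - \<phi> y) (at y)"
    and int: "set_integrable lborel {0<..} (\<lambda>y. exp (- (m * of_real y)) * \<phi> y)"
    and u0: "(u \<longlongrightarrow> u0) (at_right 0)"
    and u1: "(u' \<longlongrightarrow> u1) (at_right 0)"
    and decay: "(u \<longlongrightarrow> 0) at_top"
  shows "m * u0 + u1 = (LINT y:{0<..}|lborel. exp (- (m * of_real y)) * \<phi> y)"
proof -
  define e where "e y = exp (- (m * of_real y))" for y :: real
  define w where "w y = e y * (u' y + m * u y)" for y
  have e: "(e has_vector_derivative - m * e y) (at y)" for y
    unfolding e_def by (rule has_vector_derivative_real_field)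
      (auto intro!: derivative_eq_intros)
  have w: "(w has_vector_derivative - (e y * \<phi> y)) (at y)" if "y > 0" for y
    unfolding w_def using that
    by (auto intro!: derivative_eq_intros has_vector_derivative_mult e u u' simp: algebra_simps power2_eq_square)
  \<comment> \<open>Expressing this derivative through \<open>w\<close> makes its limit known as
    soon as that of \<open>w\<close> is. Decay is given for \<open>u\<close> only, so the limit of
    \<open>w\<close> has to be found indirectly.\<close>
  have eu: "((\<lambda>y. e y * u y) has_vector_derivative w y - 2 * m * (e y * u y)) (at y)" if "y > 0" for y
    using has_vector_derivative_mult[OF e u[OF that]] by (simp add: w_def algebra_simps)
  have "(e \<longlongrightarrow> 0) at_top"
  proof (rule tendsto_norm_zero_cancel)
    have "filterlim (\<lambda>y. Re m * y) at_top at_top"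
      by (rule filterlim_tendsto_pos_mult_at_top[OF tendsto_const m filterlim_ident])
    then have "((\<lambda>y. exp (- (Re m * y))) \<longlongrightarrow> 0) at_top"
      by (intro filterlim_compose[OF exp_at_bot]) (simp add: filterlim_uminus_at_top)
    then show "((\<lambda>y. norm (e y)) \<longlongrightarrow> 0) at_top"
      by (simp add: e_def norm_exp_eq_Re)
  qed
  then have eu_lim: "((\<lambda>y. e y * u y) \<longlongrightarrow> 0) at_top"
    using tendsto_mult[OF _ decay] by fastforce
  \<comment> \<open>The differential equation holds for \<open>y > 0\<close> only, so the
    integration starts at some \<open>a > 0\<close>; the limit \<open>a\<close> to 0 is taken
    afterwards.\<close>
  have w_eq: "w a = (LINT y:{a..}|lborel. e y * \<phi> y)" if a: "a > 0" for a
  proof -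
    define L where "L = w a + (LINT y:{a..}|lborel. - (e y * \<phi> y))"
    have int_a: "set_integrable lborel {a..} (\<lambda>y. e y * \<phi> y)"
      using a unfolding e_def by (intro set_integrable_subset[OF int]) auto
    have "(w \<longlongrightarrow> L) at_top" unfolding L_def
      using a int_a by (intro tendsto_at_top_of_integrable_derivative w) (auto simp: set_integrable_def)
    \<comment> \<open>Since \<open>e y * u y\<close> tends to 0, its derivative tends to the limit
      \<open>L\<close> of \<open>w\<close>. As the function itself converges,
      \<open>L = 0\<close>.\<close>
    then have "((\<lambda>y. w y - 2 * m * (e y * u y)) \<longlongrightarrow> L - 2 * m * 0) at_top"
      by (intro tendsto_intros eu_lim)
    then have "L - 2 * m * 0 = 0"
      using a eu by (intro tendsto_derivative_at_top_zero[OF _ eu_lim, of a]) auto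
    then show ?thesis by (simp add: L_def set_lebesgue_integral_def)
  qed
  \<comment> \<open>Along \<open>1 / (n + 1)\<close> the value of \<open>w\<close> has two limits:
    one from the boundary values of \<open>u\<close> and \<open>u'\<close>, one from the half-lines
    increasing to \<open>{0<..}\<close>. Equating them gives the relation.\<close>
  have r: "filterlim (\<lambda>n. 1 / real (Suc n)) (at_right 0) sequentially"
    unfolding filterlim_at using lim_1_over_n[THEN LIMSEQ_Suc] by auto
  have "(e \<longlongrightarrow> e 0) (at_right 0)"
    using has_vector_derivative_continuous[OF e, of 0]
    by (simp add: continuous_at tendsto_within_subset[of _ _ _ UNIV])
  then have "(w \<longlongrightarrow> e 0 * (u1 + m * u0)) (at_right 0)"
    unfolding w_def by (intro tendsto_intros u0 u1)
  then have "(\<lambda>n. w (1 / real (Suc n))) \<longlonglongrightarrow> u1 + m * u0"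
    using filterlim_compose[OF _ r] by (simp add: e_def)
  moreover have "(\<lambda>n. w (1 / real (Suc n))) \<longlonglongrightarrow> (LINT y:{0<..}|lborel. e y * \<phi> y)"
  proof -
    have inc: "incseq (\<lambda>n. {1 / real (Suc n)..})"
      by (rule incseq_SucI) (auto simp: field_simps)
    have un: "(\<Union>n. {1 / real (Suc n)..}) = {0<..}"
    proof (intro set_eqI iffI)
      fix x :: real assume "x \<in> {0<..}"
      then obtain n where "inverse (real (Suc n)) < x" using reals_Archimedean by auto
      then show "x \<in> (\<Union>n. {1 / real (Suc n)..})" by (auto simp: inverse_eq_divide intro!: exI[of _ n])
    next
      fix x :: real assume "x \<in> (\<Union>n. {1 / real (Suc n)..})"
      then obtain n where "1 / real (Suc n) \<le> x" by auto
      then show "x \<in> {0<..}" using less_le_trans[of 0 "1 / real (Suc n)" x] by simp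
    qed
    have "w (1 / real (Suc n)) = (LINT y:{1 / real (Suc n)..}|lborel. e y * \<phi> y)" for n
      by (rule w_eq) simp
    moreover have "(\<lambda>n. LINT y:{1 / real (Suc n)..}|lborel. e y * \<phi> y) \<longlonglongrightarrow>
        (LINT y:(\<Union>n. {1 / real (Suc n)..})|lborel. e y * \<phi> y)"
      using int by (intro set_integral_cont_up inc) (simp_all only: un e_def, simp_all)
    ultimately show ?thesis by (simp only: un)
  qed
  ultimately show ?thesis by (auto dest: LIMSEQ_unique simp: e_def add.commute)
qed

section \<open>Fourier transform in the tangential variables\<close>

lemma integrable2_add: "integrable2 g \<Longrightarrow> integrable2 h \<Longrightarrow> integrable2 (\<lambda>t x. g t x + h t x)"
  unfolding integrable2_def by (rule Bochner_Integration.integrable_add)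

lemma integrable2_cmult: "integrable2 g \<Longrightarrow> integrable2 (\<lambda>t x. a * g t x)"
  unfolding integrable2_def by (rule integrable_mult_right)

lemma integrable2_character_mult:
  assumes "integrable2 g"
  shows "integrable lborel (\<lambda>z. exp (- (\<i> * of_real (\<delta> * fst z + \<eta> * snd z))) * g (fst z) (snd z))"
proof (rule Bochner_Integration.integrable_bound)
  show "integrable lborel (\<lambda>z. g (fst z) (snd z))"
    using assms by (simp add: integrable2_def)
  have "(\<lambda>z :: real \<times> real. exp (- (\<i> * of_real (\<delta> * fst z + \<eta> * snd z))) :: complex) \<in> borel_measurable borel"
    by (intro borel_measurable_continuous_onI continuous_intros)
  then show "(\<lambda>z. exp (- (\<i> * of_real (\<delta> * fst z + \<eta> * snd z))) * g (fst z) (snd z)) \<in> borel_measurable lborel"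
    using assms by (intro borel_measurable_times) (auto simp: integrable2_def)
qed (simp add: norm_mult)

lemma fourier_add:
  "integrable2 g \<Longrightarrow> integrable2 h \<Longrightarrow>
    fourier (\<lambda>t x. g t x + h t x) \<delta> \<eta> = fourier g \<delta> \<eta> + fourier h \<delta> \<eta>"
  unfolding fourier_def distrib_left
  by (intro Bochner_Integration.integral_add integrable2_character_mult)

text \<open>Stated for every \<open>g\<close>: the integral of a non-integrable function is 0 by
  convention, so scalars always pull out.\<close>

lemma fourier_cmult: "fourier (\<lambda>t x. a * g t x) \<delta> \<eta> = a * fourier g \<delta> \<eta>"
  unfolding fourier_def by (simp add: mult.left_commute)

lemma fourier_zero: "fourier (\<lambda>t x. 0) \<delta> \<eta> = 0"
  by (simp add: fourier_def)

text \<open>The \<open>t\<close>-derivative of character times \<open>h\<close> is the character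
  times \<open>Dt h - \<i> \<delta> h\<close>. Its integral over the plane vanishes by Fubini,
  integrating in \<open>t\<close> first.\<close>

lemma fourier_Dt:
  assumes diff: "\<And>t x. (\<lambda>s. h s x) differentiable (at t)"
    and h: "integrable2 h" and Dh: "integrable2 (Dt h)"
  shows "fourier (Dt h) \<delta> \<eta> = \<i> * of_real \<delta> * fourier h \<delta> \<eta>"
proof -
  define e where "e t x = exp (- (\<i> * of_real (\<delta> * t + \<eta> * x)))" for t x :: real
  define K where "K t x = e t x * h t x" for t x
  define K' where "K' t x = e t x * (Dt h t x - \<i> * of_real \<delta> * h t x)" for t x
  have K: "integrable (lborel \<Otimes>\<^sub>M lborel) (case_prod K)"
    using integrable2_character_mult[OF h, of \<delta> \<eta>]
    by (simp add: K_def e_def lborel_prod split_beta')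
  have DK: "integrable lborel (\<lambda>z. e (fst z) (snd z) * Dt h (fst z) (snd z))"
    and hK: "integrable lborel (\<lambda>z. e (fst z) (snd z) * h (fst z) (snd z))"
    using integrable2_character_mult[OF h, of \<delta> \<eta>] integrable2_character_mult[OF Dh, of \<delta> \<eta>]
    by (simp_all add: e_def)
  have K'_eq: "case_prod K' = (\<lambda>z. e (fst z) (snd z) * Dt h (fst z) (snd z)
      - \<i> * of_real \<delta> * (e (fst z) (snd z) * h (fst z) (snd z)))"
    by (auto simp: K'_def algebra_simps)
  have K': "integrable (lborel \<Otimes>\<^sub>M lborel) (case_prod K')"
    unfolding K'_eq lborel_prod by (intro Bochner_Integration.integrable_diff integrable_mult_right DK hK)
  have deriv: "((\<lambda>s. K s x) has_vector_derivative K' t x) (at t)" for t x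
  proof -
    have "((\<lambda>s. e s x) has_vector_derivative - \<i> * of_real \<delta> * e t x) (at t)"
    proof -
      \<comment> \<open>The character is differentiated in a complex variable and then restricted to
        the real line.\<close>
      have "((\<lambda>z. exp (- (\<i> * (of_real \<delta> * z + of_real (\<eta> * x))))) has_field_derivative
          - \<i> * of_real \<delta> * e t x) (at (of_real t))"
        by (auto intro!: derivative_eq_intros simp: e_def)
      then show ?thesis
        using has_vector_derivative_real_field by (fastforce simp: e_def)
    qed
    moreover have "((\<lambda>s. h s x) has_vector_derivative Dt h t x) (at t)"
      using diff[of x t] by (simp add: Dt_def vector_derivative_works)
    ultimately show ?thesis unfolding K_def K'_def
      by (rule has_vector_derivative_eq_rhs[OF has_vector_derivative_mult]) (simp add: algebra_simps)
  qed
  have "(LINT z|lborel. case_prod K' z) = (LINT x|lborel. LINT t|lborel. K' t x)"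
    using lborel_pair.integral_snd[OF K'] by (simp add: lborel_prod)
  also have "\<dots> = (LINT x|(lborel :: real measure). 0)"
  proof (rule integral_cong_AE)
    \<comment> \<open>Fubini makes the sections of \<open>K\<close> and \<open>K'\<close> integrable
      only for almost every \<open>x\<close>.\<close>
    show "AE x in lborel. (LINT t|lborel. K' t x) = 0"
      using lborel_pair.AE_integrable_snd[OF K] lborel_pair.AE_integrable_snd[OF K']
      by eventually_elim (rule integral_derivative_zero[OF deriv])
    show "(\<lambda>x. LINT t|lborel. K' t x) \<in> borel_measurable lborel"
      using lborel_pair.integrable_snd[OF K'] by (rule borel_measurable_integrable)
  qed auto
  finally have "(LINT z|lborel. case_prod K' z) = 0" by simp
  then show ?thesis unfolding K'_eq using DK hK
    by (simp add: fourier_def e_def)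
qed

text \<open>Exchanging the variables preserves Lebesgue measure; this reduces the rule for the
  \<open>x\<close>-derivative to the one for the \<open>t\<close>-derivative.\<close>

lemma integrable2_swap: "integrable2 h \<Longrightarrow> integrable2 (\<lambda>t x. h x t)"
  using lborel_pair.integrable_product_swap[of "\<lambda>z. h (fst z) (snd z)"]
  by (simp add: integrable2_def lborel_prod split_beta')

lemma fourier_swap: "integrable2 h \<Longrightarrow> fourier (\<lambda>t x. h x t) \<delta> \<eta> = fourier h \<eta> \<delta>"
  using lborel_pair.integral_product_swap[OF borel_measurable_integrable,
      of "\<lambda>z. exp (- (\<i> * of_real (\<eta> * fst z + \<delta> * snd z))) * h (fst z) (snd z)"]
    integrable2_character_mult[of h \<eta> \<delta>]
  by (simp add: fourier_def lborel_prod split_beta' add.commute)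

lemma fourier_D1:
  assumes diff: "\<And>t x. (\<lambda>y. h t y) differentiable (at x)"
    and h: "integrable2 h" and Dh: "integrable2 (D1 h)"
  shows "fourier (D1 h) \<delta> \<eta> = \<i> * of_real \<eta> * fourier h \<delta> \<eta>"
proof -
  have eq: "Dt (\<lambda>x t. h t x) = (\<lambda>x t. D1 h t x)"
    by (intro ext) (simp add: Dt_def D1_def)
  have "fourier (Dt (\<lambda>x t. h t x)) \<eta> \<delta> = \<i> * of_real \<eta> * fourier (\<lambda>x t. h t x) \<eta> \<delta>"
    by (rule fourier_Dt) (use diff h Dh in \<open>auto simp: eq intro: integrable2_swap\<close>)
  then show ?thesis using h Dh by (simp add: eq fourier_swap)
qed

section \<open>Symbols of the tangential operators\<close>

text \<open>One layer of \<open>tangentially_regular\<close>, isolated so that first-order operators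
  can be transformed one at a time.\<close>

definition first_order_regular :: "(real \<Rightarrow> real \<Rightarrow> complex) \<Rightarrow> bool" where
  "first_order_regular h \<longleftrightarrow>
     (\<forall>t x. (\<lambda>s. h s x) differentiable (at t) \<and> (\<lambda>y. h t y) differentiable (at x)) \<and>
     integrable2 h \<and> integrable2 (Dt h) \<and> integrable2 (D1 h)"

lemma tangentially_regular_iff:
  "tangentially_regular g \<longleftrightarrow>
     first_order_regular g \<and> first_order_regular (Dt g) \<and> first_order_regular (D1 g)"
  unfolding tangentially_regular_def first_order_regular_def by blast

text \<open>The operator has symbol \<open>\<tau> + \<i> v \<eta>\<close>. The integrability claim
  supplies the side condition of \<open>fourier_add\<close> when the operator occurs in a
  sum.\<close>

lemma fourier_transport:
  assumes "first_order_regular h"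
  shows "fourier (transport \<gamma> v h) \<delta> \<eta> =
      (of_real \<gamma> + \<i> * of_real \<delta> + \<i> * of_real v * of_real \<eta>) * fourier h \<delta> \<eta>"
    and "integrable2 (transport \<gamma> v h)"
proof -
  have eq: "transport \<gamma> v h = (\<lambda>t x. (of_real \<gamma> * h t x + Dt h t x) + of_real v * D1 h t x)"
    by (intro ext) (simp add: transport_def)
  show "fourier (transport \<gamma> v h) \<delta> \<eta> =
      (of_real \<gamma> + \<i> * of_real \<delta> + \<i> * of_real v * of_real \<eta>) * fourier h \<delta> \<eta>"
    using assms unfolding eq first_order_regular_def
    by (subst fourier_add fourier_cmult fourier_Dt fourier_D1;
        simp add: integrable2_add integrable2_cmult fourier_add fourier_cmult fourier_Dt fourier_D1 algebra_simps)
  show "integrable2 (transport \<gamma> v h)"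
    using assms unfolding eq first_order_regular_def
    by (intro integrable2_add integrable2_cmult) auto
qed

lemma first_order_regular_add:
  assumes "first_order_regular g" "first_order_regular h"
  shows "first_order_regular (\<lambda>t x. g t x + h t x)"
proof -
  have "Dt (\<lambda>t x. g t x + h t x) = (\<lambda>t x. Dt g t x + Dt h t x)"
    "D1 (\<lambda>t x. g t x + h t x) = (\<lambda>t x. D1 g t x + D1 h t x)"
    using assms unfolding first_order_regular_def Dt_def D1_def
    by (auto intro!: ext vector_derivative_at has_vector_derivative_add simp: vector_derivative_works[symmetric])
  then show ?thesis using assms unfolding first_order_regular_def
    by (auto intro: integrable2_add)
qed

lemma first_order_regular_cmult:
  assumes "first_order_regular g"
  shows "first_order_regular (\<lambda>t x. a * g t x)"
proof -
  have "Dt (\<lambda>t x. a * g t x) = (\<lambda>t x. a * Dt g t x)" "D1 (\<lambda>t x. a * g t x) = (\<lambda>t x. a * D1 g t x)"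
    using assms unfolding first_order_regular_def Dt_def D1_def
    by (auto intro!: ext vector_derivative_at has_vector_derivative_mult_right simp: vector_derivative_works[symmetric])
  then show ?thesis using assms unfolding first_order_regular_def
    by (auto intro: integrable2_cmult)
qed

text \<open>The image is a linear combination of \<open>g\<close>, \<open>Dt g\<close> and
  \<open>D1 g\<close>, each regular to first order. Hence \<open>fourier_transport\<close> can be
  used a second time for the square of the operator.\<close>

lemma first_order_regular_transport:
  assumes "tangentially_regular g"
  shows "first_order_regular (transport \<gamma> v g)"
proof -
  have "transport \<gamma> v g = (\<lambda>t x. (of_real \<gamma> * g t x + Dt g t x) + of_real v * D1 g t x)"
    by (intro ext) (simp add: transport_def)
  then show ?thesis using assms unfolding tangentially_regular_iff
    by (auto intro!: first_order_regular_add first_order_regular_cmult)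
qed

lemma fourier_transport_transport:
  assumes "tangentially_regular g"
  shows "fourier (transport \<gamma> v (transport \<gamma> v g)) \<delta> \<eta> =
      (of_real \<gamma> + \<i> * of_real \<delta> + \<i> * of_real v * of_real \<eta>)\<^sup>2 * fourier g \<delta> \<eta>"
  using assms
  by (simp add: fourier_transport first_order_regular_transport tangentially_regular_iff power2_eq_square)

lemma fourier_D1_D1:
  assumes "tangentially_regular g"
  shows "fourier (D1 (D1 g)) \<delta> \<eta> = - (of_real \<eta>)\<^sup>2 * fourier g \<delta> \<eta>"
  using assms unfolding tangentially_regular_iff first_order_regular_def
  by (simp add: fourier_D1 power2_eq_square algebra_simps)

section \<open>From the wave equations to one boundary relation on each side\<close>

lemma mu_properties:
  assumes "c > 0" and "Re \<tau> > 0"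
  shows "(mu c v \<tau> \<eta>)\<^sup>2 = ((\<tau> + \<i> * of_real v * of_real \<eta>) / of_real c)\<^sup>2 + (of_real \<eta>)\<^sup>2"
    and "Re (mu c v \<tau> \<eta>) > 0"
  using theI'[OF mu_ex1[OF assms, of v \<eta>]] unfolding mu_def by auto

lemma regular_onD:
  assumes "regular_on S P" and "x \<in> S"
  shows "tangentially_regular (slice P x)"
    and "integrable2 (slice (D2 (D2 P)) x)"
    and "((\<lambda>y. pfourier P \<delta> \<eta> y) has_vector_derivative pfourier (D2 P) \<delta> \<eta> x) (at x)"
    and "((\<lambda>y. pfourier (D2 P) \<delta> \<eta> y) has_vector_derivative pfourier (D2 (D2 P)) \<delta> \<eta> x) (at x)"
  using assms unfolding regular_on_def normally_regular_def by blast+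

lemma regular_on_traceD:
  assumes "regular_on S P"
  shows "((\<lambda>y. pfourier P \<delta> \<eta> y) \<longlongrightarrow> fourier (bdry_trace S P) \<delta> \<eta>) (at 0 within S)"
    and "((\<lambda>y. pfourier (D2 P) \<delta> \<eta> y) \<longlongrightarrow> fourier (bdry_trace S (D2 P)) \<delta> \<eta>) (at 0 within S)"
    and "integrable2 (bdry_trace S (D2 P))"
    and "\<exists>l. ((\<lambda>y. D2 P t x1 y) \<longlongrightarrow> l) (at 0 within S)"
  using assms unfolding regular_on_def normally_regular_def by blast+

text \<open>Transforming the tangential derivatives and dividing by \<open>c\<^sup>2\<close> leaves
  the coefficient \<open>(T / c)\<^sup>2 + \<eta>\<^sup>2\<close>, with \<open>T\<close> the symbol
  of the transport operator; this is the square of \<open>mu\<close>.\<close>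

lemma pfourier_wave_equation:
  assumes c: "c > 0" and \<gamma>: "\<gamma> > 0"
    and reg: "regular_on S P" and x2: "x2 \<in> S"
    and eq: "\<And>t x1. transport \<gamma> v (transport \<gamma> v (slice P x2)) t x1
        - of_real (c\<^sup>2) * laplacian P t x1 x2 = F t x1 x2"
  shows "pfourier (D2 (D2 P)) \<delta> \<eta> x2 =
    (mu c v (of_real \<gamma> + \<i> * of_real \<delta>) \<eta>)\<^sup>2 * pfourier P \<delta> \<eta> x2 - pfourier F \<delta> \<eta> x2 / (of_real c)\<^sup>2"
proof -
  let ?T = "of_real \<gamma> + \<i> * of_real \<delta> + \<i> * of_real v * of_real \<eta> :: complex"
  note tr = regular_onD(1)[OF reg x2]
  have i1: "integrable2 (transport \<gamma> v (transport \<gamma> v (slice P x2)))"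
    by (intro fourier_transport(2) first_order_regular_transport tr)
  have i2: "integrable2 (D1 (D1 (slice P x2)))"
    using tr by (auto simp: tangentially_regular_iff first_order_regular_def)
  have i3: "integrable2 (slice (D2 (D2 P)) x2)" by (rule regular_onD[OF reg x2])
  \<comment> \<open>The difference is written as a sum with a negative coefficient, the form to
    which \<open>fourier_add\<close> and \<open>fourier_cmult\<close> apply.\<close>
  have "slice F x2 = (\<lambda>t x1. transport \<gamma> v (transport \<gamma> v (slice P x2)) t x1
      + - (of_real c)\<^sup>2 * (D1 (D1 (slice P x2)) t x1 + slice (D2 (D2 P)) x2 t x1))"
    by (intro ext) (simp add: slice_def[of F] eq[symmetric] laplacian_def slice_def[of "D2 (D2 P)"])
  then have "pfourier F \<delta> \<eta> x2 = ?T\<^sup>2 * pfourier P \<delta> \<eta> x2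
      + - (of_real c)\<^sup>2 * (- (of_real \<eta>)\<^sup>2 * pfourier P \<delta> \<eta> x2 + pfourier (D2 (D2 P)) \<delta> \<eta> x2)"
    unfolding pfourier_def using tr
    by (simp only: fourier_add fourier_cmult i1 i2 i3 integrable2_add integrable2_cmult
        fourier_transport_transport fourier_D1_D1)
  moreover have "(mu c v (of_real \<gamma> + \<i> * of_real \<delta>) \<eta>)\<^sup>2 = (?T / of_real c)\<^sup>2 + (of_real \<eta>)\<^sup>2"
    using c \<gamma> by (intro mu_properties(1)) auto
  ultimately show ?thesis
    using c by (simp add: field_simps)
qed

text \<open>The half-line relation applied to the transform of \<open>P\<close>, with source
  \<open>F / c\<^sup>2\<close>.\<close>

lemma upper_boundary_relation:
  fixes \<gamma> v c \<delta> \<eta> :: real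
  defines "\<mu> \<equiv> mu c v (of_real \<gamma> + \<i> * of_real \<delta>) \<eta>"
  assumes c: "c > 0" and \<gamma>: "\<gamma> > 0"
    and reg: "regular_on {0<..} P"
    and eq: "\<And>t x1 x2. x2 > 0 \<Longrightarrow> transport \<gamma> v (transport \<gamma> v (slice P x2)) t x1
        - of_real (c\<^sup>2) * laplacian P t x1 x2 = F t x1 x2"
    and int: "set_integrable lborel {0<..} (\<lambda>y. exp (- (\<mu> * of_real y)) * pfourier F \<delta> \<eta> y)"
    and decay: "((\<lambda>y. pfourier P \<delta> \<eta> y) \<longlongrightarrow> 0) at_top"
  shows "\<mu> * fourier (bdry_trace {0<..} P) \<delta> \<eta> + fourier (bdry_trace {0<..} (D2 P)) \<delta> \<eta> =
    (LINT y:{0<..}|lborel. exp (- (\<mu> * of_real y)) * pfourier F \<delta> \<eta> y) / (of_real c)\<^sup>2"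
proof -
  have "\<mu> * fourier (bdry_trace {0<..} P) \<delta> \<eta> + fourier (bdry_trace {0<..} (D2 P)) \<delta> \<eta> =
    (LINT y:{0<..}|lborel. exp (- (\<mu> * of_real y)) * (pfourier F \<delta> \<eta> y / (of_real c)\<^sup>2))"
  proof (rule decaying_solution_boundary_relation)
    show "Re \<mu> > 0" unfolding \<mu>_def using c \<gamma> by (intro mu_properties(2)) auto
    show "((\<lambda>y. pfourier P \<delta> \<eta> y) has_vector_derivative pfourier (D2 P) \<delta> \<eta> y) (at y)"
      if "y > 0" for y
      using that by (intro regular_onD[OF reg]) auto
    show "((\<lambda>y. pfourier (D2 P) \<delta> \<eta> y) has_vector_derivative
        \<mu>\<^sup>2 * pfourier P \<delta> \<eta> y - pfourier F \<delta> \<eta> y / (of_real c)\<^sup>2) (at y)" if "y > 0" for y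
      using that regular_onD(4)[OF reg, of y \<delta> \<eta>]
        pfourier_wave_equation[OF c \<gamma> reg, of y v F \<delta> \<eta>] eq unfolding \<mu>_def by simp
    show "set_integrable lborel {0<..}
        (\<lambda>y. exp (- (\<mu> * of_real y)) * (pfourier F \<delta> \<eta> y / (of_real c)\<^sup>2))"
      using set_integrable_mult_left[OF int, of "1 / (of_real c)\<^sup>2"] by simp
  qed (use decay regular_on_traceD[OF reg] in auto)
  then show ?thesis by simp
qed

text \<open>Reflecting \<open>x2\<close> reduces this to the positive half-line. The equation keeps
  its form, while the first normal derivative changes sign.\<close>

lemma lower_boundary_relation:
  fixes \<gamma> v c \<delta> \<eta> :: real
  defines "\<mu> \<equiv> mu c v (of_real \<gamma> + \<i> * of_real \<delta>) \<eta>"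
  assumes c: "c > 0" and \<gamma>: "\<gamma> > 0"
    and reg: "regular_on {..<0} P"
    and eq: "\<And>t x1 x2. x2 < 0 \<Longrightarrow> transport \<gamma> v (transport \<gamma> v (slice P x2)) t x1
        - of_real (c\<^sup>2) * laplacian P t x1 x2 = F t x1 x2"
    and int: "set_integrable lborel {0<..} (\<lambda>y. exp (- (\<mu> * of_real y)) * pfourier F \<delta> \<eta> (- y))"
    and decay: "((\<lambda>y. pfourier P \<delta> \<eta> (- y)) \<longlongrightarrow> 0) at_top"
  shows "\<mu> * fourier (bdry_trace {..<0} P) \<delta> \<eta> - fourier (bdry_trace {..<0} (D2 P)) \<delta> \<eta> =
    (LINT y:{0<..}|lborel. exp (- (\<mu> * of_real y)) * pfourier F \<delta> \<eta> (- y)) / (of_real c)\<^sup>2"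
proof -
  have trace: "((\<lambda>y. h (- y)) \<longlongrightarrow> l) (at_right 0)"
    if "(h \<longlongrightarrow> l) (at_left 0)" for h :: "real \<Rightarrow> complex" and l
    using that by (simp add: filterlim_at_left_to_right[of _ _ 0])
  have "\<mu> * fourier (bdry_trace {..<0} P) \<delta> \<eta> + - fourier (bdry_trace {..<0} (D2 P)) \<delta> \<eta> =
    (LINT y:{0<..}|lborel. exp (- (\<mu> * of_real y)) * (pfourier F \<delta> \<eta> (- y) / (of_real c)\<^sup>2))"
  proof (rule decaying_solution_boundary_relation)
    show "Re \<mu> > 0" unfolding \<mu>_def using c \<gamma> by (intro mu_properties(2)) auto
    show "((\<lambda>y. pfourier P \<delta> \<eta> (- y)) has_vector_derivative - pfourier (D2 P) \<delta> \<eta> (- y)) (at y)"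
      if "y > 0" for y
      using that by (intro has_vector_derivative_reflect regular_onD[OF reg]) auto
    show "((\<lambda>y. - pfourier (D2 P) \<delta> \<eta> (- y)) has_vector_derivative
        \<mu>\<^sup>2 * pfourier P \<delta> \<eta> (- y) - pfourier F \<delta> \<eta> (- y) / (of_real c)\<^sup>2) (at y)" if "y > 0" for y
      using that has_vector_derivative_minus[OF has_vector_derivative_reflect[OF regular_onD(4)[OF reg, of "- y" \<delta> \<eta>]]]
        pfourier_wave_equation[OF c \<gamma> reg, of "- y" v F \<delta> \<eta>] eq unfolding \<mu>_def by simp
    show "set_integrable lborel {0<..}
        (\<lambda>y. exp (- (\<mu> * of_real y)) * (pfourier F \<delta> \<eta> (- y) / (of_real c)\<^sup>2))"
      using set_integrable_mult_left[OF int, of "1 / (of_real c)\<^sup>2"] by simp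
    show "((\<lambda>y. - pfourier (D2 P) \<delta> \<eta> (- y)) \<longlongrightarrow> - fourier (bdry_trace {..<0} (D2 P)) \<delta> \<eta>) (at_right 0)"
      by (intro tendsto_minus trace regular_on_traceD[OF reg])
  qed (use decay in \<open>auto intro: trace regular_on_traceD[OF reg]\<close>)
  then show ?thesis by simp
qed

section \<open>Boundary traces, elimination and the front equation\<close>

text \<open>The jump condition has the factor \<open>c\<^sup>2\<close> inside the trace, the front
  equation has it outside; this reconciles them. \<open>Lim\<close> has a meaningful value only
  where the limit exists and is unique.\<close>

lemma bdry_trace_cmult:
  assumes "\<exists>l. ((\<lambda>y. g t x1 y) \<longlongrightarrow> l) (at 0 within S)" and "at (0 :: real) within S \<noteq> bot"
  shows "bdry_trace S (\<lambda>t x1 y. a * g t x1 y) t x1 = a * bdry_trace S g t x1"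
proof -
  from assms obtain l where l: "((\<lambda>y. g t x1 y) \<longlongrightarrow> l) (at 0 within S)" by blast
  have "((\<lambda>y. a * g t x1 y) \<longlongrightarrow> a * l) (at 0 within S)"
    by (intro tendsto_intros l)
  with l assms(2) show ?thesis
    unfolding bdry_trace_def by (simp add: tendsto_Lim)
qed

text \<open>The coefficient of \<open>\<phi>\<close> comes from \<open>c\<^sup>2 (\<mu>\<^sub>+\<^sup>2 - \<mu>\<^sub>-\<^sup>2) = 4 \<i> V \<eta> T\<close>, so that
  \<open>\<mu>\<^sub>+ - \<mu>\<^sub>-\<close> is eliminated in favour of \<open>\<mu>\<^sub>+ + \<mu>\<^sub>-\<close>.\<close>

lemma boundary_system_elimination:
  fixes c T V \<eta> \<phi> p dp dm Ap Am mp mm :: complex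
  assumes nz: "c \<noteq> 0" "mp \<noteq> 0" "mm \<noteq> 0" "mp + mm \<noteq> 0"
    and mu2: "c\<^sup>2 * (mp\<^sup>2 - mm\<^sup>2) = 4 * \<i> * V * \<eta> * T"
    and upper: "mp * p + dp = Ap / c\<^sup>2"
    and lower: "mm * p - dm = Am / c\<^sup>2"
    and jump: "c\<^sup>2 * (dp - dm) = - 4 * V * T * (\<i> * \<eta> * \<phi>)"
    and front: "T\<^sup>2 * \<phi> - V\<^sup>2 * \<eta>\<^sup>2 * \<phi> + c\<^sup>2 / 2 * (dp + dm) = 0"
  shows "(T\<^sup>2 + V\<^sup>2 * \<eta>\<^sup>2 * (8 * T\<^sup>2 / (c\<^sup>2 * (mp + mm)\<^sup>2) - 1)) * \<phi>
    + mp * mm / (mp + mm) * (1 / mp * Ap - 1 / mm * Am) = 0"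
proof -
  define s where "s = mp + mm"
  define q where "q = \<i> * V * \<eta> * T"
  have s: "s \<noteq> 0" using nz by (simp add: s_def)
  have Ap: "Ap = c\<^sup>2 * (mp * p + dp)" and Am: "Am = c\<^sup>2 * (mm * p - dm)"
    using upper lower nz(1) by (simp_all add: field_simps)
  have diff: "c\<^sup>2 * s * (mp - mm) = 4 * q"
    using mu2 by (simp add: s_def q_def algebra_simps power2_eq_square)
  have j: "c\<^sup>2 * (dp - dm) = - 4 * q * \<phi>"
    using jump by (simp add: q_def algebra_simps)
  \<comment> \<open>The factor \<open>mp * mm\<close> clears the denominators in the source
    term.\<close>
  have M: "mp * mm / s * (1 / mp * Ap - 1 / mm * Am) = (mm * Ap - mp * Am) / s"
    using nz s by (simp add: field_simps)
  \<comment> \<open>The common boundary value \<open>p\<close> cancels, and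
    \<open>mm * dp + mp * dm\<close> is split into the sum and the difference of the normal
    derivatives: the front equation governs the former, the jump condition the latter.\<close>
  have "2 * (mm * Ap - mp * Am) = c\<^sup>2 * (s * (dp + dm) - (mp - mm) * (dp - dm))"
    by (simp add: Ap Am s_def algebra_simps)
  also have "\<dots> = s * (c\<^sup>2 * (dp + dm)) - (mp - mm) * (c\<^sup>2 * (dp - dm))"
    by (simp add: algebra_simps)
  also have "\<dots> = s * (c\<^sup>2 * (dp + dm)) + (mp - mm) * (4 * q * \<phi>)"
    unfolding j by simp
  finally have "2 * (mm * Ap - mp * Am) = s * (c\<^sup>2 * (dp + dm)) + (mp - mm) * (4 * q * \<phi>)" .
  moreover have "mp - mm = 4 * q / (c\<^sup>2 * s)"
    using diff nz s by (simp add: field_simps)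
  ultimately have "2 * (mm * Ap - mp * Am) / s =
      (s * (c\<^sup>2 * (dp + dm)) + 4 * q / (c\<^sup>2 * s) * (4 * q * \<phi>)) / s"
    by (simp only:)
  also have "\<dots> = c\<^sup>2 * (dp + dm) + 16 * q\<^sup>2 * \<phi> / (c\<^sup>2 * s\<^sup>2)"
    using s by (simp add: add_divide_distrib power2_eq_square mult_ac)
  finally have "2 * (mm * Ap - mp * Am) / s = c\<^sup>2 * (dp + dm) + 16 * q\<^sup>2 * \<phi> / (c\<^sup>2 * s\<^sup>2)" .
  \<comment> \<open>The square of \<open>\<i>\<close> gives the sign, and halving 16 gives the
    constant 8 of the claim.\<close>
  moreover have "q\<^sup>2 = - (V\<^sup>2 * \<eta>\<^sup>2 * T\<^sup>2)"
    by (simp add: q_def power_mult_distrib)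
  ultimately have "(mm * Ap - mp * Am) / s =
      c\<^sup>2 / 2 * (dp + dm) - 8 * V\<^sup>2 * \<eta>\<^sup>2 * T\<^sup>2 / (c\<^sup>2 * s\<^sup>2) * \<phi>"
    by (simp add: field_simps)
  \<comment> \<open>The two terms with the constant 8 cancel, and what remains is the left side of
    the front equation.\<close>
  then have "(T\<^sup>2 + V\<^sup>2 * \<eta>\<^sup>2 * (8 * T\<^sup>2 / (c\<^sup>2 * s\<^sup>2) - 1)) * \<phi>
      + mp * mm / s * (1 / mp * Ap - 1 / mm * Am) =
      T\<^sup>2 * \<phi> - V\<^sup>2 * \<eta>\<^sup>2 * \<phi> + c\<^sup>2 / 2 * (dp + dm)"
    unfolding M by (simp add: algebra_simps)
  then show ?thesis by (simp only: front s_def)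
qed

theorem theorem3p1:
  fixes c vp vm w1 V1 \<gamma> :: real
    and f :: "real \<Rightarrow> real \<Rightarrow> complex"
    and Pp Pm Fp Fm :: "real \<Rightarrow> real \<Rightarrow> real \<Rightarrow> complex"
  assumes c: "c > 0"
    and w1: "w1 = (vp + vm) / 2"
    and V1: "V1 = (vp - vm) / 2"
    and \<gamma>: "\<gamma> \<ge> 1"
    and f_regular: "tangentially_regular f"
    and Pp_regular: "regular_on {0<..} Pp"
    and Pm_regular: "regular_on {..<0} Pm"
    and Fp_integrable:
      "\<And>\<delta> \<eta> :: real. set_integrable lborel {0<..}
         (\<lambda>y :: real. exp (- (mu c vp (of_real \<gamma> + \<i> * of_real \<delta>) \<eta> * of_real y)) * pfourier Fp \<delta> \<eta> y)"
    and Fm_integrable: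
      "\<And>\<delta> \<eta> :: real. set_integrable lborel {0<..}
         (\<lambda>y :: real. exp (- (mu c vm (of_real \<gamma> + \<i> * of_real \<delta>) \<eta> * of_real y)) * pfourier Fm \<delta> \<eta> (- y))"
    and Fp_lim: "\<And>\<delta> \<eta> :: real. ((\<lambda>x2 :: real. pfourier Fp \<delta> \<eta> x2) \<longlongrightarrow> 0) at_top"
    and Fm_lim: "\<And>\<delta> \<eta> :: real. ((\<lambda>x2 :: real. pfourier Fm \<delta> \<eta> (- x2)) \<longlongrightarrow> 0) at_top"
    and front_eq:
      "\<And>t x1 :: real. transport \<gamma> w1 (transport \<gamma> w1 f) t x1 + of_real (V1\<^sup>2) * D1 (D1 f) t x1
         + of_real (c\<^sup>2 / 2) * (bdry_trace {0<..} (D2 Pp) t x1 + bdry_trace {..<0} (D2 Pm) t x1) = 0"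
    and Pp_eq:
      "\<And>t x1 x2 :: real. x2 > 0 \<Longrightarrow>
         transport \<gamma> vp (transport \<gamma> vp (slice Pp x2)) t x1
           - of_real (c\<^sup>2) * laplacian Pp t x1 x2 = Fp t x1 x2"
    and Pm_eq:
      "\<And>t x1 x2 :: real. x2 < 0 \<Longrightarrow>
         transport \<gamma> vm (transport \<gamma> vm (slice Pm x2)) t x1
           - of_real (c\<^sup>2) * laplacian Pm t x1 x2 = Fm t x1 x2"
    and jump_P: "\<And>t x1 :: real. jump Pp Pm t x1 = 0"
    and jump_DP:
      "\<And>t x1 :: real. jump (\<lambda>t x1 x2 :: real. of_real (c\<^sup>2) * D2 Pp t x1 x2)
              (\<lambda>t x1 x2 :: real. of_real (c\<^sup>2) * D2 Pm t x1 x2) t x1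
         = - 4 * of_real V1 * transport \<gamma> w1 (D1 f) t x1"
    and Pp_lim: "\<And>\<delta> \<eta> :: real. ((\<lambda>x2 :: real. pfourier Pp \<delta> \<eta> x2) \<longlongrightarrow> 0) at_top"
    and Pm_lim: "\<And>\<delta> \<eta> :: real. ((\<lambda>x2 :: real. pfourier Pm \<delta> \<eta> (- x2)) \<longlongrightarrow> 0) at_top"
  shows "\<forall>\<delta> \<eta> :: real.
    (let \<tau> = of_real \<gamma> + \<i> * of_real \<delta>;
         mp = mu c vp \<tau> \<eta>;
         mm = mu c vm \<tau> \<eta>;
         M = source_term mp mm Fp Fm \<delta> \<eta>
     in ((\<tau> + \<i> * of_real w1 * of_real \<eta>)\<^sup>2
          + (of_real V1)\<^sup>2 * (of_real \<eta>)\<^sup>2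
            * (8 * (\<tau> + \<i> * of_real w1 * of_real \<eta>)\<^sup>2 / ((of_real c)\<^sup>2 * (mp + mm)\<^sup>2) - 1))
          * fourier f \<delta> \<eta>
        + mp * mm / (mp + mm) * M = 0)"
proof (intro allI)
  fix \<delta> \<eta> :: real
  define \<tau> :: complex where "\<tau> = of_real \<gamma> + \<i> * of_real \<delta>"
  define mp where "mp = mu c vp \<tau> \<eta>"
  define mm where "mm = mu c vm \<tau> \<eta>"
  define T where "T = \<tau> + \<i> * of_real w1 * of_real \<eta>"
  define Ap where "Ap = (LINT y:{0<..}|lborel. exp (- (mp * of_real y)) * pfourier Fp \<delta> \<eta> y)"
  define Am where "Am = (LINT y:{0<..}|lborel. exp (- (mm * of_real y)) * pfourier Fm \<delta> \<eta> (- y))"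
  define tp where "tp = bdry_trace {0<..} (D2 Pp)"
  define tm where "tm = bdry_trace {..<0} (D2 Pm)"
  have \<tau>: "Re \<tau> > 0" and \<gamma>0: "\<gamma> > 0" using \<gamma> by (simp_all add: \<tau>_def)
  note mup = mu_properties[OF c \<tau>, of vp \<eta>, folded mp_def]
  note mum = mu_properties[OF c \<tau>, of vm \<eta>, folded mm_def]
  have itp: "integrable2 tp" and itm: "integrable2 tm"
    unfolding tp_def tm_def by (rule regular_on_traceD[OF Pp_regular] regular_on_traceD[OF Pm_regular])+
  have f: "first_order_regular f" "first_order_regular (D1 f)" "integrable2 (D1 (D1 f))"
    using f_regular by (auto simp: tangentially_regular_iff first_order_regular_def)
  \<comment> \<open>Continuity of the pressure gives both boundary relations the same unknown
    boundary value.\<close>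
  have trace_P: "bdry_trace {..<0} Pm = bdry_trace {0<..} Pp"
    using jump_P by (intro ext) (simp add: jump_def)
  have upper: "mp * fourier (bdry_trace {0<..} Pp) \<delta> \<eta> + fourier tp \<delta> \<eta> = Ap / (of_real c)\<^sup>2"
    unfolding mp_def \<tau>_def tp_def Ap_def
    by (rule upper_boundary_relation[OF c \<gamma>0 Pp_regular Pp_eq Fp_integrable Pp_lim])
  have lower: "mm * fourier (bdry_trace {0<..} Pp) \<delta> \<eta> - fourier tm \<delta> \<eta> = Am / (of_real c)\<^sup>2"
    unfolding mm_def \<tau>_def tm_def Am_def trace_P[symmetric]
    by (rule lower_boundary_relation[OF c \<gamma>0 Pm_regular Pm_eq Fm_integrable Pm_lim])
  have jump: "(of_real c)\<^sup>2 * (fourier tp \<delta> \<eta> - fourier tm \<delta> \<eta>) =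
      - 4 * of_real V1 * T * (\<i> * of_real \<eta> * fourier f \<delta> \<eta>)"
  proof -
    have "(\<lambda>t x1. (of_real c)\<^sup>2 * (tp t x1 + (- 1) * tm t x1)) =
        (\<lambda>t x1. - 4 * of_real V1 * transport \<gamma> w1 (D1 f) t x1)"
    proof (intro ext)
      fix t x1
      \<comment> \<open>The existing one-sided limits of the normal derivatives let the factor leave
        the trace.\<close>
      have "jump (\<lambda>t x1 x2. of_real (c\<^sup>2) * D2 Pp t x1 x2) (\<lambda>t x1 x2. of_real (c\<^sup>2) * D2 Pm t x1 x2) t x1
          = of_real (c\<^sup>2) * tp t x1 - of_real (c\<^sup>2) * tm t x1"
        unfolding jump_def tp_def tm_def
        using regular_on_traceD(4)[OF Pp_regular] regular_on_traceD(4)[OF Pm_regular]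
        by (simp only: bdry_trace_cmult trivial_limit_at_right_real trivial_limit_at_left_real not_False_eq_True)
      then show "(of_real c)\<^sup>2 * (tp t x1 + (- 1) * tm t x1) = - 4 * of_real V1 * transport \<gamma> w1 (D1 f) t x1"
        using jump_DP[of t x1] by (simp add: algebra_simps)
    qed
    then have "fourier (\<lambda>t x1. (of_real c)\<^sup>2 * (tp t x1 + (- 1) * tm t x1)) \<delta> \<eta> =
        fourier (\<lambda>t x1. - 4 * of_real V1 * transport \<gamma> w1 (D1 f) t x1) \<delta> \<eta>"
      by (rule arg_cong)
    moreover have "fourier (D1 f) \<delta> \<eta> = \<i> * of_real \<eta> * fourier f \<delta> \<eta>"
      using f(1) by (intro fourier_D1) (auto simp: first_order_regular_def)
    ultimately show ?thesis
      unfolding fourier_cmult fourier_add[OF itp integrable2_cmult[OF itm]] fourier_transport(1)[OF f(2)]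
      by (simp add: T_def \<tau>_def mult.assoc)
  qed
  have front: "T\<^sup>2 * fourier f \<delta> \<eta> - (of_real V1)\<^sup>2 * (of_real \<eta>)\<^sup>2 * fourier f \<delta> \<eta>
      + (of_real c)\<^sup>2 / 2 * (fourier tp \<delta> \<eta> + fourier tm \<delta> \<eta>) = 0"
  proof -
    have "fourier (\<lambda>t x1. (transport \<gamma> w1 (transport \<gamma> w1 f) t x1 + of_real (V1\<^sup>2) * D1 (D1 f) t x1)
        + of_real (c\<^sup>2 / 2) * (tp t x1 + tm t x1)) \<delta> \<eta> = 0"
      unfolding tp_def tm_def front_eq by (rule fourier_zero)
    moreover have "integrable2 (transport \<gamma> w1 (transport \<gamma> w1 f))"
      by (intro fourier_transport(2) first_order_regular_transport f_regular)
    ultimately have "(fourier (transport \<gamma> w1 (transport \<gamma> w1 f)) \<delta> \<eta>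
        + of_real (V1\<^sup>2) * fourier (D1 (D1 f)) \<delta> \<eta>)
        + of_real (c\<^sup>2 / 2) * (fourier tp \<delta> \<eta> + fourier tm \<delta> \<eta>) = 0"
      by (simp only: fourier_add fourier_cmult integrable2_add integrable2_cmult f itp itm)
    then show ?thesis
      by (simp add: fourier_transport_transport[OF f_regular] fourier_D1_D1[OF f_regular] T_def \<tau>_def mult.assoc)
  qed
  have mu2: "(of_real c)\<^sup>2 * (mp\<^sup>2 - mm\<^sup>2) = 4 * \<i> * of_real V1 * of_real \<eta> * T"
  proof -
    \<comment> \<open>Hence \<open>\<tau> + \<i> v \<eta>\<close> equals
      \<open>T + \<i> V1 \<eta>\<close> above and \<open>T - \<i> V1 \<eta>\<close> below, and the
      difference of their squares is \<open>4 \<i> V1 \<eta> T\<close>.\<close>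
    have v: "vp = w1 + V1" "vm = w1 - V1" by (simp_all add: w1 V1 field_simps)
    have "(of_real c)\<^sup>2 * (mp\<^sup>2 - mm\<^sup>2) =
        (\<tau> + \<i> * of_real vp * of_real \<eta>)\<^sup>2 - (\<tau> + \<i> * of_real vm * of_real \<eta>)\<^sup>2"
      using c by (simp add: mup mum field_simps)
    then show ?thesis
      by (simp add: v T_def power2_eq_square algebra_simps)
  qed
  \<comment> \<open>Both roots have positive real part, hence so does their sum.\<close>
  have "mp \<noteq> 0" "mm \<noteq> 0" "mp + mm \<noteq> 0"
    using mup(2) mum(2) by (auto simp: complex_eq_iff)
  then show "let \<tau> = of_real \<gamma> + \<i> * of_real \<delta>;
         mp = mu c vp \<tau> \<eta>;
         mm = mu c vm \<tau> \<eta>;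
         M = source_term mp mm Fp Fm \<delta> \<eta>
     in ((\<tau> + \<i> * of_real w1 * of_real \<eta>)\<^sup>2
          + (of_real V1)\<^sup>2 * (of_real \<eta>)\<^sup>2
            * (8 * (\<tau> + \<i> * of_real w1 * of_real \<eta>)\<^sup>2 / ((of_real c)\<^sup>2 * (mp + mm)\<^sup>2) - 1))
          * fourier f \<delta> \<eta>
        + mp * mm / (mp + mm) * M = 0"
    using boundary_system_elimination[OF _ _ _ _ mu2 upper lower jump front] c
    unfolding Let_def source_term_def \<tau>_def[symmetric] mp_def[symmetric] mm_def[symmetric]
      T_def[symmetric] Ap_def[symmetric] Am_def[symmetric]
    by simp
qed

end
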